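(* Let $V$ be a Banach space that is reflexive or whose dual $V^\ast$ is separable. Let $F:V\to\mathbb{R}$ be continuous, coercive and sequentially weakly lower semicontinuous, let $\mathbf{K}\subset V$ be non-empty, closed and convex, and let $Y$ be a dense subspace of $V$. Let $\{R_n\}_{n\in\mathbb{N}}$ be a sequence of quasi-monotone perturbations of the indicator function $i_{\mathbf{K}}$ with respect to $Y$. If $$\overline{\mathbf{K}\cap Y}^{V}=\mathbf{K}$$ (closure in the norm of $V$), then $F+i_{\mathbf{K}}$ is the $\Gamma$-limit of $F+R_n$ both in the weak and in the strong (norm) topology of $V$; that is, for all $u\in V$, $$\Gamma\text{-}\lim_{n\to\infty}(F+R_n)(u)=\Gamma_w\text{-}\lim_{n\to\infty}(F+R_n)(u)=F(u)+i_{\mathbf{K}}(u).$$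
   Context: For a set $C\subset V$, the indicator function $i_C:V\to\mathbb{R}\cup\{+\infty\}$ equals $0$ on $C$ and $+\infty$ outside $C$. Quasi-monotone perturbations: a sequence $R_n:V\to\mathbb{R}\cup\{+\infty\}$ is a sequence of quasi-monotone perturbations of $i_{\mathbf{K}}$ with respect to the dense subspace $Y$ if there exist functions $\underline{R}_n,\overline{R}_n:V\to\mathbb{R}\cup\{+\infty\}$ with $0\le\underline{R}_n\le R_n\le\overline{R}_n$ for all $n\in\mathbb{N}$ such that: (a) $\underline{R}_n\le\underline{R}_{n+1}$ for all $n$, $\lim_{n\to\infty}\underline{R}_n(u)=i_{\mathbf{K}}(u)$ for all $u\in V$, and each $\underline{R}_n$ is sequentially weakly lower semicontinuous (if $v_k\rightharpoonup v$ then $\underline{R}_n(v)\le\liminf_k\underline{R}_n(v_k)$); (b) $\overline{R}_n\ge\overline{R}_{n+1}$ for all $n$, and $\lim_{n\to\infty}\overline{R}_n(u)=i_{\mathbf{K}\cap Y}(u)$ for all $u\in V$. No further assumptions are made on $R_n$. $\Gamma$-limits: for $G_n:V\to\mathbb{R}\cup\{+\infty\}$ and $u\in V$, $$\Gamma\text{-}\limsup_{n\to\infty}G_n(u)=\sup_{U\in\mathcal{N}(u)}\limsup_{n\to\infty}\inf_{w\in U}G_n(w),\qquad \Gamma\text{-}\liminf_{n\to\infty}G_n(u)=\sup_{U\in\mathcal{N}(u)}\liminf_{n\to\infty}\inf_{w\in U}G_n(w),$$ where $\mathcal{N}(u)$ is the set of all open neighborhoods of $u$ in the norm topology. $\Gamma_w\text{-}\limsup$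 and $\Gamma_w\text{-}\liminf$ are defined analogously with open neighborhoods in the weak topology. If the upper and lower limits agree, their common value is denoted $\Gamma\text{-}\lim$ (resp. $\Gamma_w\text{-}\lim$). Coercive means $F(u)\to+\infty$ as $\|u\|\to\infty$. *)

theory Defs
  imports "HOL-Analysis.Analysis"
begin

lift_definition canonical_embedding ::
    "'a::real_normed_vector \<Rightarrow> ('a \<Rightarrow>\<^sub>L real) \<Rightarrow>\<^sub>L real"
  is "\<lambda>x f. blinfun_apply f x"
  by (rule blinfun.bounded_linear_left)

definition reflexive_space :: "'a::real_normed_vector itself \<Rightarrow> bool"
  where "reflexive_space _ \<longleftrightarrow>
    surj (canonical_embedding :: 'a \<Rightarrow> ('a \<Rightarrow>\<^sub>L real) \<Rightarrow>\<^sub>L real)"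

definition separable_dual :: "'a::real_normed_vector itself \<Rightarrow> bool"
  where "separable_dual _ \<longleftrightarrow>
    separable_space (euclidean :: ('a \<Rightarrow>\<^sub>L real) topology)"

definition weak_topology :: "'a::real_normed_vector topology"
  where "weak_topology =
    topology_generated_by {blinfun_apply f -` S |(f :: 'a \<Rightarrow>\<^sub>L real) S. open S}"

lemma topspace_weak_topology [simp]: "topspace weak_topology = UNIV"
proof -
  have "UNIV = blinfun_apply (0 :: 'a \<Rightarrow>\<^sub>L real) -` UNIV" by simp
  then show ?thesis
    unfolding weak_topology_def topology_generated_by_topspace by blast
qed

lemma limitin_weak_topology_iff:
  fixes x :: "'b \<Rightarrow> 'a::real_normed_vector"
  shows "limitin weak_topology x l A \<longleftrightarrow>
    (\<forall>f :: 'a \<Rightarrow>\<^sub>L real. ((\<lambda>i. blinfun_apply f (x i)) \<longlongrightarrow> blinfun_apply f l) A)"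
proof (intro iffI allI)
  fix f :: "'a \<Rightarrow>\<^sub>L real"
  assume lim: "limitin weak_topology x l A"
  show "((\<lambda>i. blinfun_apply f (x i)) \<longlongrightarrow> blinfun_apply f l) A"
  proof (rule topological_tendstoI)
    fix S :: "real set" assume S: "open S" "blinfun_apply f l \<in> S"
    have "openin weak_topology (blinfun_apply f -` S)"
      unfolding weak_topology_def using S(1)
      by (intro topology_generated_by_Basis) blast
    with lim S(2) have "\<forall>\<^sub>F i in A. x i \<in> blinfun_apply f -` S"
      unfolding limitin_def by blast
    then show "\<forall>\<^sub>F i in A. blinfun_apply f (x i) \<in> S" by simp
  qed
next
  assume conv: "\<forall>f :: 'a \<Rightarrow>\<^sub>L real. ((\<lambda>i. blinfun_apply f (x i)) \<longlongrightarrow> blinfun_apply f l) A"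
  have *: "l \<in> U \<longrightarrow> (\<forall>\<^sub>F i in A. x i \<in> U)"
    if "generate_topology_on {blinfun_apply f -` S |(f :: 'a \<Rightarrow>\<^sub>L real) S. open S} U" for U
    using that
  proof induction
    case (UN K)
    show ?case
    proof
      assume "l \<in> \<Union>K"
      then obtain k where k: "k \<in> K" "l \<in> k" by blast
      with UN have "\<forall>\<^sub>F i in A. x i \<in> k" by blast
      then show "\<forall>\<^sub>F i in A. x i \<in> \<Union>K"
        by (rule eventually_mono) (use k in blast)
    qed
  next
    case (Basis s)
    then obtain f :: "'a \<Rightarrow>\<^sub>L real" and S where s: "s = blinfun_apply f -` S" "open S"
      by blast
    show ?case
      using topological_tendstoD[OF conv[rule_format, of f] s(2)] s(1) by simp
  qed (auto elim: eventually_elim2)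
  show "limitin weak_topology x l A"
    unfolding limitin_def
  proof (intro conjI allI impI)
    show "l \<in> topspace weak_topology" by simp
  next
    fix U assume "openin weak_topology U \<and> l \<in> U"
    then show "\<forall>\<^sub>F i in A. x i \<in> U"
      using * by (simp add: weak_topology_def openin_topology_generated_by_iff)
  qed
qed

definition seq_weakly_lsc :: "('a::real_normed_vector \<Rightarrow> ereal) \<Rightarrow> bool"
  where "seq_weakly_lsc G \<longleftrightarrow>
    (\<forall>x v. limitin weak_topology x v sequentially \<longrightarrow> G v \<le> liminf (\<lambda>k. G (x k)))"

definition coercive :: "('a::real_normed_vector \<Rightarrow> real) \<Rightarrow> bool"
  where "coercive F \<longleftrightarrow> filterlim F at_top at_infinity"

definition ext_indicator :: "'a set \<Rightarrow> 'a \<Rightarrow> ereal"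
  where "ext_indicator C u = (if u \<in> C then 0 else \<infinity>)"

text \<open>
  Functions with values in \<open>\<real> \<union> {+\<infinity>}\<close> are rendered as functions into \<^typ>\<open>ereal\<close>; the
  value \<open>-\<infinity>\<close> is excluded for \<open>R\<close>, \<open>Rl\<close> and \<open>Ru\<close> by \<open>0 \<le> Rl n u \<le> R n u \<le> Ru n u\<close>.
\<close>

definition quasi_monotone_perturbations ::
    "'a::real_normed_vector set \<Rightarrow> 'a set \<Rightarrow> (nat \<Rightarrow> 'a \<Rightarrow> ereal) \<Rightarrow> bool"
  where "quasi_monotone_perturbations K Y R \<longleftrightarrow>
    (\<exists>Rl Ru :: nat \<Rightarrow> 'a \<Rightarrow> ereal.
      (\<forall>n u. 0 \<le> Rl n u \<and> Rl n u \<le> R n u \<and> R n u \<le> Ru n u) \<and>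
      (\<forall>n u. Rl n u \<le> Rl (Suc n) u) \<and>
      (\<forall>u. (\<lambda>n. Rl n u) \<longlonglongrightarrow> ext_indicator K u) \<and>
      (\<forall>n. seq_weakly_lsc (Rl n)) \<and>
      (\<forall>n u. Ru (Suc n) u \<le> Ru n u) \<and>
      (\<forall>u. (\<lambda>n. Ru n u) \<longlonglongrightarrow> ext_indicator (K \<inter> Y) u))"

definition Gamma_limsup :: "'a topology \<Rightarrow> (nat \<Rightarrow> 'a \<Rightarrow> ereal) \<Rightarrow> 'a \<Rightarrow> ereal"
  where "Gamma_limsup T G u =
    (SUP U \<in> {U. openin T U \<and> u \<in> U}. limsup (\<lambda>n. INF w \<in> U. G n w))"

definition Gamma_liminf :: "'a topology \<Rightarrow> (nat \<Rightarrow> 'a \<Rightarrow> ereal) \<Rightarrow> 'a \<Rightarrow> ereal"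
  where "Gamma_liminf T G u =
    (SUP U \<in> {U. openin T U \<and> u \<in> U}. liminf (\<lambda>n. INF w \<in> U. G n w))"

definition has_Gamma_limit_at ::
    "'a topology \<Rightarrow> (nat \<Rightarrow> 'a \<Rightarrow> ereal) \<Rightarrow> 'a \<Rightarrow> ereal \<Rightarrow> bool"
  where "has_Gamma_limit_at T G u l \<longleftrightarrow> Gamma_limsup T G u = l \<and> Gamma_liminf T G u = l"

end

theory Submission
  imports Defs
begin

text \<open>
  Write \<open>G n = F + R n\<close>. The Gamma-liminf never exceeds the Gamma-limsup, and both only get smaller
  when the topology gets coarser. Since weakly open sets are open, it suffices to bound the strong
  Gamma-limsup from above by \<open>F + i\<^sub>K\<close> and the weak Gamma-liminf from below by the same function.

  The upper bound (\<open>strong_Gamma_limsup_upper_bound\<close>) uses density of \<open>K \<inter> Y\<close> in \<open>K\<close>, continuity of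
  \<open>F\<close>, and the fact that the upper perturbations tend to 0 at each point of \<open>K \<inter> Y\<close>.

  For the lower bound (\<open>weak_Gamma_liminf_lower_bound\<close>), \<open>G n\<close> lies above \<open>F\<close> plus the lower
  perturbation, and these sums increase pointwise to \<open>F + i\<^sub>K\<close>. For an increasing sequence of
  functions that are lower semicontinuous in the weak topology, the weak Gamma-liminf is at least the
  pointwise limit. The hypotheses, however, give lower semicontinuity along sequences only. The gap is
  closed by coercivity: sublevel sets are bounded, and in a reflexive space or a space with separable
  dual every point of the weak closure of a bounded set is the weak limit of a sequence from
  this set, so that weakly sequentially closed bounded sets are weakly closed
  (\<open>seq_weakly_closed_imp_closedin_weak\<close>).

  With a separable dual a diagonal choice produces such a sequence. In the reflexive case it comes
  from Whitley's proof of the Eberlein-Smulian theorem, which rests on weak compactness of bounded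
  sets (via Tychonoff) and on functionals provided by the Hahn-Banach theorem; the latter is derived
  here from Zorn's lemma.
\<close>

section \<open>The Hahn-Banach theorem\<close>

text \<open>
  A partial linear functional is encoded by its graph, a subspace of \<open>V \<times> \<real>\<close>, and domination by
  \<open>c\<parallel>x\<parallel>\<close> makes such a subspace automatically single-valued. Extension then means inclusion of
  sets, Zorn's lemma applies directly, and adjoining one vector is adjoining one pair to a span.
\<close>
lemma Hahn_Banach_graph:
  fixes G :: "('a::real_normed_vector \<times> real) set"
  assumes G: "subspace G" and c: "0 \<le> c" and le: "\<And>x t. (x, t) \<in> G \<Longrightarrow> t \<le> c * norm x"
  shows "\<exists>f :: 'a \<Rightarrow>\<^sub>L real. (\<forall>(x, t) \<in> G. blinfun_apply f x = t) \<and> (\<forall>x. blinfun_apply f x \<le> c * norm x)"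
proof -
  define \<A> where "\<A> = {H. subspace H \<and> G \<subseteq> H \<and> (\<forall>(x, t) \<in> H. t \<le> c * norm x)}"
  have "\<exists>M\<in>\<A>. \<forall>X\<in>\<A>. M \<subseteq> X \<longrightarrow> X = M"
  proof (rule subset_Zorn_nonempty)
    show "\<A> \<noteq> {}" using G le by (auto simp: \<A>_def)
  next
    fix \<C> assume ne: "\<C> \<noteq> {}" and ch: "subset.chain \<A> \<C>"
    have sub: "subspace H" "G \<subseteq> H" "\<And>x t. (x, t) \<in> H \<Longrightarrow> t \<le> c * norm x" if "H \<in> \<C>" for H
      using ch that unfolding subset_chain_def \<A>_def by blast+
    have "subspace (\<Union>\<C>)"
      unfolding subspace_def
    proof (intro conjI ballI allI)
      show "0 \<in> \<Union>\<C>" using ne sub(1) subspace_0 by blast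
    next
      fix x y assume "x \<in> \<Union>\<C>" "y \<in> \<Union>\<C>"
      then obtain H where "H \<in> \<C>" "x \<in> H" "y \<in> H"
        using ch unfolding subset_chain_def by blast
      then show "x + y \<in> \<Union>\<C>" using sub(1) subspace_add by blast
    next
      fix k :: real and x assume "x \<in> \<Union>\<C>"
      then show "k *\<^sub>R x \<in> \<Union>\<C>" using sub(1) subspace_scale by blast
    qed
    moreover have "G \<subseteq> \<Union>\<C>" using ne sub(2) by blast
    ultimately show "\<Union>\<C> \<in> \<A>" using sub(3) by (auto simp: \<A>_def)
  qed
  then obtain M where M: "M \<in> \<A>" and maxM: "\<And>X. X \<in> \<A> \<Longrightarrow> M \<subseteq> X \<Longrightarrow> X = M" by blast
  have sM: "subspace M" and GM: "G \<subseteq> M" and leM: "\<And>x t. (x, t) \<in> M \<Longrightarrow> t \<le> c * norm x"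
    using M by (auto simp: \<A>_def)
  have uniq: "t = s" if "(x, t) \<in> M" "(x, s) \<in> M" for x t s
    using leM[of 0 "t - s"] leM[of 0 "s - t"] subspace_diff[OF sM that] subspace_diff[OF sM that(2) that(1)]
    by simp
  \<comment> \<open>Maximality forces the domain to be all of \<open>V\<close>: otherwise a pair \<open>(x0, s)\<close> could be adjoined.\<close>
  have total: "\<exists>t. (x0, t) \<in> M" for x0
  proof -
    have sep: "t' - c * norm (x' - x0) \<le> c * norm (x + x0) - t" if "(x, t) \<in> M" "(x', t') \<in> M" for x t x' t'
    proof -
      have "t + t' \<le> c * norm (x + x')"
        using leM subspace_add[OF sM that] by simp
      also have "\<dots> \<le> c * (norm (x + x0) + norm (x' - x0))"
        using norm_triangle_ineq[of "x + x0" "x' - x0"] c by (intro mult_left_mono) auto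
      finally show ?thesis by (simp add: algebra_simps)
    qed
    \<comment> \<open>Adjoining \<open>(x0, s)\<close> preserves domination iff \<open>s\<close> lies above \<open>L\<close> and below every right-hand side in \<open>sep\<close>.\<close>
    define L where "L = (\<lambda>(x', t'). t' - c * norm (x' - x0)) ` M"
    define s where "s = Sup L"
    have zM: "(0, 0) \<in> M" using subspace_0[OF sM] by (simp add: zero_prod_def)
    have bd: "bdd_above L"
      using sep[OF zM] by (intro bdd_aboveI[of _ "c * norm x0"]) (auto simp: L_def)
    have s1: "t' - s \<le> c * norm (x' - x0)" if "(x', t') \<in> M" for x' t'
      using cSup_upper[OF _ bd, of "t' - c * norm (x' - x0)"] that
      by (force simp: L_def s_def)
    have s2: "t + s \<le> c * norm (x + x0)" if "(x, t) \<in> M" for x t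
    proof -
      have "s \<le> c * norm (x + x0) - t"
        unfolding s_def
      proof (rule cSup_least)
        show "L \<noteq> {}" using zM by (auto simp: L_def)
      qed (auto simp: L_def intro: sep[OF that])
      then show ?thesis by simp
    qed
    define H where "H = span (insert (x0, s) M)"
    have "t \<le> c * norm x" if xtH: "(x, t) \<in> H" for x t
    proof -
      obtain k where "(x, t) - k *\<^sub>R (x0, s) \<in> span M"
        using xtH unfolding H_def span_breakdown_eq ..
      moreover have "span M = M" using sM by (simp only: span_eq_iff)
      ultimately have k: "(x, t) - k *\<^sub>R (x0, s) \<in> M" by (simp only:)
      define y r where "y = x - k *\<^sub>R x0" and "r = t - k * s"
      have yr: "(y, r) \<in> M" using k by (simp add: y_def r_def)
      have xt: "x = y + k *\<^sub>R x0" "t = r + k * s" by (simp_all add: y_def r_def)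
      consider "k = 0" | "k > 0" | "k < 0" by linarith
      then show ?thesis
      proof cases
        case 1 then show ?thesis using leM[OF yr] xt by simp
      next
        case 2
        have "(y /\<^sub>R k, r / k) \<in> M"
          using subspace_scale[OF sM yr, of "inverse k"] by (simp add: divide_inverse mult.commute)
        from s2[OF this] have "k * (r / k + s) \<le> k * (c * norm (y /\<^sub>R k + x0))"
          using 2 by (intro mult_left_mono) auto
        also have "\<dots> = c * norm (k *\<^sub>R (y /\<^sub>R k + x0))" using 2 by simp
        also have "k *\<^sub>R (y /\<^sub>R k + x0) = x" using 2 xt by (simp add: scaleR_add_right)
        also have "k * (r / k + s) = t" using 2 xt(2) by (simp add: distrib_left)
        finally show ?thesis .
      next
        case 3
        define j where "j = - k"
        have j: "j > 0" "k = - j" using 3 by (auto simp: j_def)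
        have "(y /\<^sub>R j, r / j) \<in> M"
          using subspace_scale[OF sM yr, of "inverse j"] by (simp add: divide_inverse mult.commute)
        from s1[OF this] have "j * (r / j - s) \<le> j * (c * norm (y /\<^sub>R j - x0))"
          using j by (intro mult_left_mono) auto
        also have "\<dots> = c * norm (j *\<^sub>R (y /\<^sub>R j - x0))" using j by simp
        also have "j *\<^sub>R (y /\<^sub>R j - x0) = x" using j xt by (simp add: scaleR_diff_right)
        also have "j * (r / j - s) = t" using j xt(2) by (simp add: right_diff_distrib)
        finally show ?thesis .
      qed
    qed
    moreover have MH: "M \<subseteq> H" "(x0, s) \<in> H"
      using span_superset[of "insert (x0, s) M"] by (auto simp: H_def)
    ultimately have "H \<in> \<A>" using GM by (auto simp: \<A>_def H_def)
    from maxM[OF this MH(1)] MH(2) show ?thesis by blast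
  qed
  define f where "f x = (THE t. (x, t) \<in> M)" for x
  have f: "(x, f x) \<in> M" for x
    unfolding f_def using total[of x] uniq by (metis theI)
  have feq: "f x = t" if "(x, t) \<in> M" for x t using uniq[OF f that] .
  have add: "f (x + y) = f x + f y" for x y
    using feq subspace_add[OF sM f[of x] f[of y]] by simp
  have scale: "f (k *\<^sub>R x) = k * f x" for k x
    using feq subspace_scale[OF sM f[of x], of k] by simp
  have fle: "f x \<le> c * norm x" for x using leM[OF f] .
  have "bounded_linear f"
  proof (rule bounded_linear_intro)
    fix x
    show "norm (f x) \<le> norm x * c"
      using fle[of x] fle[of "- x"] scale[of "-1" x] by (simp add: abs_le_iff mult.commute)
  qed (use add scale in auto)
  then have "blinfun_apply (Blinfun f) = f" by (rule bounded_linear_Blinfun_apply)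
  then show ?thesis using feq GM fle by (intro exI[of _ "Blinfun f"]) auto
qed

text \<open>
  Hahn-Banach for the functional \<open>t w \<mapsto> t \<parallel>w\<parallel>\<close> on the line through \<open>w\<close>. The graph form covers
  \<open>w = 0\<close> as well.
\<close>
lemma norming_functional:
  fixes w :: "'a::real_normed_vector"
  shows "\<exists>f :: 'a \<Rightarrow>\<^sub>L real. blinfun_apply f w = norm w \<and> (\<forall>x. blinfun_apply f x \<le> norm x)"
proof -
  let ?G = "range (\<lambda>t. (t *\<^sub>R w, t * norm w))"
  have "?G = span {(w, norm w)}" by (simp add: span_singleton)
  then have "subspace ?G" by (metis subspace_span)
  then have "\<exists>f :: 'a \<Rightarrow>\<^sub>L real. (\<forall>(x, t) \<in> ?G. blinfun_apply f x = t) \<and> (\<forall>x. blinfun_apply f x \<le> 1 * norm x)"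
    by (rule Hahn_Banach_graph) (auto intro!: mult_right_mono abs_ge_self)
  then obtain f :: "'a \<Rightarrow>\<^sub>L real" where f: "\<forall>(x, t) \<in> ?G. blinfun_apply f x = t" "\<forall>x. blinfun_apply f x \<le> norm x"
    by auto
  have "(w, norm w) \<in> ?G" by (rule image_eqI[of _ _ 1]) auto
  from bspec[OF f(1) this] f(2) show ?thesis by auto
qed

text \<open>
  If \<open>d\<close> is a positive lower bound for the distance from \<open>x\<close> to \<open>W\<close>, then \<open>w + t x \<mapsto> t\<close> is dominated by
  \<open>\<parallel>\<cdot>\<parallel> / d\<close>, so Hahn-Banach extends it from \<open>W + \<real> x\<close> to \<open>V\<close>.
\<close>
lemma separating_functional:
  fixes W :: "'a::real_normed_vector set"
  assumes W: "subspace W" "closed W" and x: "x \<notin> W"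
  shows "\<exists>f :: 'a \<Rightarrow>\<^sub>L real. (\<forall>w \<in> W. blinfun_apply f w = 0) \<and> blinfun_apply f x = 1"
proof -
  obtain d where d: "d > 0" "\<And>y. dist x y < d \<Longrightarrow> y \<notin> W"
    using openE[of "- W" x] W(2) x by (auto simp: open_Compl subset_iff)
  let ?G = "span (insert (x, 1 :: real) (W \<times> {0}))"
  have sW: "span (W \<times> {0 :: real}) = W \<times> {0}"
    using W(1) by (subst span_eq_iff) (simp add: subspace_Times)
  have bound: "t \<le> inverse d * norm y" if "(y, t) \<in> ?G" for y t
  proof -
    have w: "y - t *\<^sub>R x \<in> W" using that unfolding span_breakdown_eq sW by auto
    show ?thesis
    proof (cases "t > 0")
      case True
      have "- ((y - t *\<^sub>R x) /\<^sub>R t) \<in> W" using w W(1) by (simp add: subspace_neg subspace_scale)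
      then have "d \<le> dist x (- ((y - t *\<^sub>R x) /\<^sub>R t))" using d(2) by (meson not_le)
      also have "\<dots> = norm (y /\<^sub>R t)" using True by (simp add: dist_norm scaleR_diff_right)
      finally show ?thesis using True d(1) by (simp add: field_simps)
    next
      case False
      moreover have "0 \<le> inverse d * norm y" using d(1) by simp
      ultimately show ?thesis by linarith
    qed
  qed
  obtain f :: "'a \<Rightarrow>\<^sub>L real" where f: "\<forall>(y, t) \<in> ?G. blinfun_apply f y = t"
    using Hahn_Banach_graph[OF subspace_span _ bound] d(1) by (meson inverse_nonnegative_iff_nonnegative less_imp_le)
  have "(x, 1) \<in> ?G" "\<And>w. w \<in> W \<Longrightarrow> (w, 0) \<in> ?G" by (auto intro: span_base)
  then have "(\<forall>w \<in> W. blinfun_apply f w = 0) \<and> blinfun_apply f x = 1" using f by fast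
  then show ?thesis ..
qed

section \<open>Weak cluster points\<close>

text \<open>
  Weak compactness of bounded sets in a reflexive space, phrased with filters so that it can be
  applied along any refinement of a sequence. The evaluations \<open>f \<mapsto> f (a i)\<close> lie in a product of
  compact intervals; by Tychonoff they have a pointwise cluster point \<open>\<phi>\<close>, which inherits linearity
  and the bound, and reflexivity represents this element of the bidual by a point of \<open>V\<close>.
\<close>
lemma bounded_weak_cluster_point:
  fixes a :: "'i \<Rightarrow> 'a::real_normed_vector"
  assumes refl: "reflexive_space TYPE('a)" and bd: "\<And>i. norm (a i) \<le> M" and G: "G \<noteq> bot"
  shows "\<exists>H x. H \<le> G \<and> H \<noteq> bot \<and> limitin weak_topology a x H"
proof -
  define ev where "ev i f = blinfun_apply f (a i)" for i and f :: "'a \<Rightarrow>\<^sub>L real"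
  define S where "S = (\<Pi>\<^sub>E f \<in> UNIV. {- (M * norm f) .. M * norm (f :: 'a \<Rightarrow>\<^sub>L real)})"
  have "compactin (product_topology (\<lambda>_. euclidean) UNIV) S"
    unfolding S_def by (subst compactin_PiE) simp
  then have "compact S" by (simp add: euclidean_product_topology)
  moreover have evS: "ev i \<in> S" for i
  proof -
    have "\<bar>ev i f\<bar> \<le> M * norm f" for f
      using norm_blinfun[of f "a i"] mult_left_mono[OF bd[of i], of "norm f"]
      by (simp add: ev_def mult.commute)
    then have "ev i f \<in> {- (M * norm f) .. M * norm f}" for f
      using abs_le_iff[of "ev i f" "M * norm f"] by auto
    then show ?thesis unfolding S_def by (simp add: PiE_iff)
  qed
  ultimately obtain \<phi> where \<phi>: "inf (nhds \<phi>) (filtermap ev G) \<noteq> bot"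
    using G unfolding compact_filter
    by (metis (no_types, lifting) always_eventually eventually_filtermap filtermap_bot_iff)
  \<comment> \<open>\<open>H\<close> refines \<open>G\<close> so that the evaluations converge to \<open>\<phi>\<close> pointwise.\<close>
  define H where "H = inf G (filtercomap ev (nhds \<phi>))"
  have HG: "H \<le> G" and Hlim: "filterlim ev (nhds \<phi>) H"
    by (simp_all add: H_def filterlim_iff_le_filtercomap)
  have Hbot: "H \<noteq> bot"
  proof
    assume "H = bot"
    then obtain P Q where PQ: "eventually P G" "eventually Q (nhds \<phi>)" "\<And>i. P i \<Longrightarrow> \<not> Q (ev i)"
      unfolding trivial_limit_def H_def eventually_inf eventually_filtercomap by blast
    have "eventually (\<lambda>x. False) (inf (nhds \<phi>) (filtermap ev G))"
      unfolding eventually_inf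
      by (rule exI[of _ Q], rule exI[of _ "\<lambda>x. \<not> Q x"])
         (use PQ in \<open>auto simp: eventually_filtermap elim: eventually_mono\<close>)
    then show False using \<phi> by (simp add: trivial_limit_def)
  qed
  have lim: "((\<lambda>i. blinfun_apply f (a i)) \<longlongrightarrow> \<phi> f) H" for f :: "'a \<Rightarrow>\<^sub>L real"
  proof (rule topological_tendstoI)
    fix S :: "real set" assume S: "open S" "\<phi> f \<in> S"
    have "open ((\<lambda>x. x f) -` S)"
      by (rule open_vimage[OF S(1) continuous_on_product_coordinates])
    then have "\<forall>\<^sub>F x in nhds \<phi>. x \<in> (\<lambda>x. x f) -` S"
      using S(2) by (intro eventually_nhds_in_open) auto
    from eventually_compose_filterlim[OF this Hlim]
    show "\<forall>\<^sub>F i in H. blinfun_apply f (a i) \<in> S" by (simp add: ev_def)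
  qed
  have "bounded_linear \<phi>"
  proof (rule bounded_linear_intro)
    fix f g show "\<phi> (f + g) = \<phi> f + \<phi> g"
      using tendsto_unique[OF Hbot lim[of "f + g"]] tendsto_add[OF lim[of f] lim[of g]]
      by (simp add: blinfun.add_left)
  next
    fix r f show "\<phi> (r *\<^sub>R f) = r *\<^sub>R \<phi> f"
      using tendsto_unique[OF Hbot lim[of "r *\<^sub>R f"]] tendsto_scaleR[OF tendsto_const lim[of f]]
      by (simp add: blinfun.scaleR_left)
  next
    fix f :: "'a \<Rightarrow>\<^sub>L real"
    have "eventually (\<lambda>i. norm (blinfun_apply f (a i)) \<le> norm f * M) H"
      using norm_blinfun[of f] bd by (intro always_eventually allI) (meson mult_left_mono norm_ge_zero order_trans)
    then show "norm (\<phi> f) \<le> norm f * M"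
      by (rule tendsto_upperbound[OF tendsto_norm[OF lim] _ Hbot])
  qed
  then have ap: "blinfun_apply (Blinfun \<phi>) = \<phi>" by (rule bounded_linear_Blinfun_apply)
  obtain x :: 'a where "Blinfun \<phi> = canonical_embedding x"
    using refl unfolding reflexive_space_def by (metis surjD)
  then have "\<phi> f = blinfun_apply f x" for f :: "'a \<Rightarrow>\<^sub>L real"
    using ap by (metis canonical_embedding.rep_eq)
  then have "limitin weak_topology a x H"
    using lim by (simp add: limitin_weak_topology_iff)
  then show ?thesis using HG Hbot by blast
qed

text \<open>
  The case of Mazur's theorem in which the convex set is a subspace.
\<close>
lemma weak_limit_in_closed_subspace:
  fixes a :: "'i \<Rightarrow> 'a::real_normed_vector"
  assumes W: "subspace W" "closed W" and a: "\<And>i. a i \<in> W"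
    and lim: "limitin weak_topology a x H" and H: "H \<noteq> bot"
  shows "x \<in> W"
proof (rule ccontr)
  assume "x \<notin> W"
  then obtain f :: "'a \<Rightarrow>\<^sub>L real" where f: "\<forall>w \<in> W. blinfun_apply f w = 0" "blinfun_apply f x = 1"
    using separating_functional[OF W] by blast
  have "((\<lambda>i. blinfun_apply f (a i)) \<longlongrightarrow> 1) H"
    using lim f(2) unfolding limitin_weak_topology_iff by metis
  moreover have "(\<lambda>i. blinfun_apply f (a i)) = (\<lambda>i. 0)" using a f(1) by auto
  ultimately have "((\<lambda>i. 0) \<longlongrightarrow> (1::real)) H" by (simp only:)
  then show False using H by (simp add: tendsto_const_iff)
qed

section \<open>Weak closures of bounded sets are reached by sequences\<close>

lemma weak_closure_approx:
  fixes A :: "'a::real_normed_vector set" and \<F> :: "('a \<Rightarrow>\<^sub>L real) set"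
  assumes u: "u \<in> weak_topology closure_of A" and fin: "finite \<F>" and e: "e > 0"
  shows "\<exists>a \<in> A. \<forall>f \<in> \<F>. \<bar>blinfun_apply f (a - u)\<bar> < e"
proof -
  define T where "T = (\<Inter>f \<in> \<F>. blinfun_apply f -` ball (blinfun_apply f u) e) \<inter> topspace weak_topology"
  have "openin weak_topology (blinfun_apply f -` ball (blinfun_apply f u) e)" for f :: "'a \<Rightarrow>\<^sub>L real"
    unfolding weak_topology_def by (rule topology_generated_by_Basis) blast
  then have "openin weak_topology T"
    unfolding T_def using fin by (cases "\<F> = {}") (auto simp flip: topspace_weak_topology intro!: openin_Inter)
  moreover have "u \<in> T" using e by (simp add: T_def)
  ultimately obtain a where "a \<in> A" "a \<in> T" using u unfolding in_closure_of by blast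
  then show ?thesis
    by (auto simp: T_def dist_real_def blinfun.diff_right abs_minus_commute intro!: bexI[of _ a])
qed

text \<open>
  The \<open>n\<close>-th member of the sequence is chosen close to \<open>u\<close> with respect to the first \<open>n\<close> members
  of a countable dense set of functionals. Boundedness of \<open>A\<close> transfers the convergence from the
  dense set to every functional.
\<close>
lemma bounded_weak_closure_sequence_separable_dual:
  fixes A :: "'a::real_normed_vector set"
  assumes sep: "separable_dual TYPE('a)" and A: "bounded A" and u: "u \<in> weak_topology closure_of A"
  shows "\<exists>a. range a \<subseteq> A \<and> limitin weak_topology a u sequentially"
proof -
  obtain D :: "('a \<Rightarrow>\<^sub>L real) set" where D: "countable D" "closure D = UNIV"
    using sep unfolding separable_dual_def separable_space_def by auto
  have Dne: "D \<noteq> {}" using D(2) by auto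
  define d where "d = from_nat_into D"
  have rd: "range d = D" using D(1) Dne by (simp add: d_def range_from_nat_into)
  have "\<forall>n. \<exists>x. x \<in> A \<and> (\<forall>f \<in> d ` {..n}. \<bar>blinfun_apply f (x - u)\<bar> < inverse (real (Suc n)))"
    using weak_closure_approx[OF u] by (metis finite_atMost finite_imageI inverse_positive_iff_positive of_nat_0_less_iff zero_less_Suc)
  then obtain a where aA: "\<And>n. a n \<in> A"
    and a: "\<And>n k. k \<le> n \<Longrightarrow> \<bar>blinfun_apply (d k) (a n - u)\<bar> < inverse (real (Suc n))"
    by (metis atMost_iff imageI)
  obtain M where M: "\<And>n. norm (a n - u) \<le> M"
  proof -
    obtain B where "\<forall>x \<in> A. norm x \<le> B" using A by (auto simp: bounded_iff)
    then have "norm (a n - u) \<le> B + norm u" for n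
      using norm_triangle_ineq4[of "a n" u] aA[of n] by (meson add_right_mono order_trans)
    then show ?thesis by (rule that)
  qed
  have "(\<lambda>n. blinfun_apply f (a n)) \<longlonglongrightarrow> blinfun_apply f u" for f :: "'a \<Rightarrow>\<^sub>L real"
  proof (rule LIMSEQ_I)
    fix e :: real assume e: "e > 0"
    have M0: "0 \<le> M" using M[of 0] norm_ge_zero order_trans by blast
    \<comment> \<open>This \<open>\<delta>\<close> keeps \<open>\<delta> M\<close> below \<open>e / 2\<close> also when \<open>M = 0\<close>.\<close>
    define \<delta> where "\<delta> = e / (2 * (M + 1))"
    have \<delta>: "\<delta> > 0" "\<delta> * M < e / 2"
      using e M0 by (auto simp: \<delta>_def field_simps)
    obtain g where g: "g \<in> D" "dist g f < \<delta>"
      using D(2) \<delta>(1) closure_approachable[of f D] by auto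
    obtain k where k: "g = d k" using g(1) rd by auto
    obtain N where N: "inverse (real (Suc N)) < e / 2"
      using reals_Archimedean[of "e / 2"] e by auto
    have "norm (blinfun_apply f (a n) - blinfun_apply f u) < e" if n: "n \<ge> max k N" for n
    proof -
      have "inverse (real (Suc n)) \<le> inverse (real (Suc N))" using n by (simp add: field_simps)
      moreover have "\<bar>blinfun_apply g (a n - u)\<bar> < inverse (real (Suc n))" using a[of k n] n k by simp
      ultimately have 1: "\<bar>blinfun_apply g (a n - u)\<bar> < e / 2" using N by linarith
      have "\<bar>blinfun_apply (f - g) (a n - u)\<bar> \<le> norm (f - g) * norm (a n - u)"
        using norm_blinfun[of "f - g" "a n - u"] by simp
      also have "\<dots> \<le> \<delta> * M"
        using g(2) M[of n] M0 \<delta>(1) by (intro mult_mono) (auto simp: dist_norm norm_minus_commute)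
      finally have "\<bar>blinfun_apply (f - g) (a n - u)\<bar> < e / 2" using \<delta>(2) by linarith
      with 1 have "\<bar>blinfun_apply f (a n - u)\<bar> < e"
        unfolding blinfun.diff_left by linarith
      then show ?thesis by (simp add: blinfun.diff_right)
    qed
    then show "\<exists>N. \<forall>n\<ge>N. norm (blinfun_apply f (a n) - blinfun_apply f u) < e" by blast
  qed
  then show ?thesis using aA by (intro exI[of _ a]) (auto simp: limitin_weak_topology_iff)
qed

text \<open>
  Rational combinations of a sequence, indexed by lists of pairs of a coefficient and a position:
  there are countably many such lists, sums correspond to concatenation, and each list refers to
  finitely many positions only, which makes a recursive choice of \<open>b\<close> possible.
\<close>
definition rat_comb :: "(nat \<Rightarrow> 'a::real_vector) \<Rightarrow> (rat \<times> nat) list \<Rightarrow> 'a" where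
  "rat_comb b q = (\<Sum>(c, i)\<leftarrow>q. real_of_rat c *\<^sub>R b i)"

lemma rat_comb_cong:
  assumes "\<And>c i. (c, i) \<in> set q \<Longrightarrow> b i = b' i"
  shows "rat_comb b q = rat_comb b' q"
  unfolding rat_comb_def using assms by (intro arg_cong[where f = sum_list] map_cong) auto

lemma rat_comb_append: "rat_comb b (q @ r) = rat_comb b q + rat_comb b r"
  by (simp add: rat_comb_def)

lemma rat_comb_scale: "rat_comb b (map (\<lambda>(c, i). (k * c, i)) q) = real_of_rat k *\<^sub>R rat_comb b q"
  by (induction q) (auto simp: rat_comb_def of_rat_mult scaleR_add_right)

lemma closure_rat_comb_subspace:
  fixes b :: "nat \<Rightarrow> 'a::real_normed_vector"
  shows "subspace (closure (range (rat_comb b)))"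
  unfolding subspace_def
proof (intro conjI ballI allI)
  have "rat_comb b [] = 0" by (simp add: rat_comb_def)
  then show "0 \<in> closure (range (rat_comb b))" by (metis closure_subset rangeI subsetD)
next
  fix x y assume "x \<in> closure (range (rat_comb b))" "y \<in> closure (range (rat_comb b))"
  then obtain p q where pq: "\<And>n. p n \<in> range (rat_comb b)" "p \<longlonglongrightarrow> x"
      "\<And>n. q n \<in> range (rat_comb b)" "q \<longlonglongrightarrow> y"
    unfolding closure_sequential by blast
  have "p n + q n \<in> range (rat_comb b)" for n
    using pq(1)[of n] pq(3)[of n] by (auto simp: rat_comb_append[symmetric])
  moreover have "(\<lambda>n. p n + q n) \<longlonglongrightarrow> x + y" using pq(2,4) by (rule tendsto_add)
  ultimately show "x + y \<in> closure (range (rat_comb b))"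
    unfolding closure_sequential by (intro exI[of _ "\<lambda>n. p n + q n"]) auto
next
  fix k :: real and x assume "x \<in> closure (range (rat_comb b))"
  then obtain p where p: "\<And>n. p n \<in> range (rat_comb b)" "p \<longlonglongrightarrow> x"
    unfolding closure_sequential by blast
  have "k \<in> closure \<rat>" by (simp add: Rats_closure_real)
  then obtain r where r: "\<And>n. r n \<in> \<rat>" "r \<longlonglongrightarrow> k" unfolding closure_sequential by blast
  have "r n *\<^sub>R p n \<in> range (rat_comb b)" for n
    using p(1)[of n] r(1)[of n] by (auto elim!: Rats_cases simp: rat_comb_scale[symmetric])
  moreover have "(\<lambda>n. r n *\<^sub>R p n) \<longlonglongrightarrow> k *\<^sub>R x" using p(2) r(2) by (intro tendsto_scaleR)
  ultimately show "k *\<^sub>R x \<in> closure (range (rat_comb b))"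
    unfolding closure_sequential by (intro exI[of _ "\<lambda>n. r n *\<^sub>R p n"]) auto
qed

text \<open>
  This is Whitley's argument for the Eberlein-Smulian theorem. Write \<open>a n = u + b n\<close> and choose
  \<open>b n\<close> recursively, so that functionals norming more and more rational combinations of the earlier
  terms of \<open>b\<close> are small at \<open>b n\<close>. Every weak cluster point \<open>x\<close> of \<open>b\<close> lies in the closed span of
  \<open>b\<close> and is annihilated by functionals that norm a dense subset of this span; hence \<open>x = 0\<close>. Since
  every refinement of the sequence has a weak cluster point, a unique cluster point is a weak limit.
\<close>
lemma bounded_weak_closure_sequence_reflexive:
  fixes A :: "'a::real_normed_vector set"
  assumes refl: "reflexive_space TYPE('a)" and A: "bounded A" and u: "u \<in> weak_topology closure_of A"
  shows "\<exists>a. range a \<subseteq> A \<and> limitin weak_topology a u sequentially"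
proof -
  obtain \<psi> :: "'a \<Rightarrow> 'a \<Rightarrow>\<^sub>L real"
    where \<psi>: "\<And>w. blinfun_apply (\<psi> w) w = norm w" "\<And>w x. blinfun_apply (\<psi> w) x \<le> norm x"
    using norming_functional by metis
  define q :: "nat \<Rightarrow> (rat \<times> nat) list" where "q = from_nat"
  \<comment> \<open>Only combinations of terms before \<open>b n\<close> are constrained, so the choice of \<open>b n\<close>
    is a course-of-values recursion; each single list is constrained from some index on.\<close>
  define P where "P b n z \<longleftrightarrow> z + u \<in> A \<and> (\<forall>k \<le> n. (\<forall>(c, i) \<in> set (q k). i < n) \<longrightarrow>
      \<bar>blinfun_apply (\<psi> (rat_comb b (q k))) z\<bar> < inverse (real (Suc n)))" for b n z
  have "\<exists>b. \<forall>n. P b n (b n)"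
  proof (rule dependent_wellorder_choice)
    fix z n and f g :: "nat \<Rightarrow> 'a" assume "\<And>y. y < n \<Longrightarrow> f y = g y"
    then have "rat_comb f (q k) = rat_comb g (q k)" if "\<forall>(c, i) \<in> set (q k). i < n" for k
      using that by (intro rat_comb_cong) auto
    then show "P f n z = P g n z" unfolding P_def by metis
  next
    fix n and b :: "nat \<Rightarrow> 'a"
    obtain a where "a \<in> A" "\<forall>f \<in> (\<lambda>k. \<psi> (rat_comb b (q k))) ` {..n}. \<bar>blinfun_apply f (a - u)\<bar> < inverse (real (Suc n))"
      using weak_closure_approx[OF u, of "(\<lambda>k. \<psi> (rat_comb b (q k))) ` {..n}" "inverse (real (Suc n))"] by auto
    then have "P b n (a - u)" by (auto simp: P_def)
    then show "\<exists>z. P b n z" ..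
  qed
  then obtain b where b: "\<And>n. P b n (b n)" by blast
  define a where "a n = b n + u" for n
  have aA: "a n \<in> A" for n using b[of n] by (simp add: P_def a_def)
  have null: "(\<lambda>n. blinfun_apply (\<psi> (rat_comb b p)) (b n)) \<longlonglongrightarrow> 0" for p
  proof (rule LIMSEQ_I)
    fix e :: real assume e: "e > 0"
    obtain k where k: "p = q k" unfolding q_def by (metis from_nat_to_nat)
    obtain m where m: "\<forall>i \<in> snd ` set p. i < m" using finite_nat_set_iff_bounded[of "snd ` set p"] by auto
    obtain N where N: "inverse (real (Suc N)) < e" using reals_Archimedean[of e] e by auto
    have "norm (blinfun_apply (\<psi> (rat_comb b p)) (b n) - 0) < e" if n: "n \<ge> max (max k m) N" for n
    proof -
      have "inverse (real (Suc n)) \<le> inverse (real (Suc N))" using n by (simp add: field_simps)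
      moreover have "\<forall>(c, i) \<in> set (q k). i < n" using m k n by fastforce
      then have "\<bar>blinfun_apply (\<psi> (rat_comb b p)) (b n)\<bar> < inverse (real (Suc n))"
        using b[of n] n k unfolding P_def by auto
      ultimately have "\<bar>blinfun_apply (\<psi> (rat_comb b p)) (b n)\<bar> < e" using N by linarith
      then show ?thesis by simp
    qed
    then show "\<exists>N. \<forall>n\<ge>N. norm (blinfun_apply (\<psi> (rat_comb b p)) (b n) - 0) < e" by blast
  qed
  obtain M where M: "\<And>n. norm (b n) \<le> M"
  proof -
    obtain B where "\<forall>x \<in> A. norm x \<le> B" using A by (auto simp: bounded_iff)
    then have "norm (b n) \<le> B + norm u" for n
      using norm_triangle_ineq4[of "a n" u] aA[of n] by (simp add: a_def) (meson add_right_mono order_trans)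
    then show ?thesis by (rule that)
  qed
  let ?W = "closure (range (rat_comb b))"
  have bW: "b i \<in> ?W" for i
  proof -
    have "rat_comb b [(1, i)] = b i" by (simp add: rat_comb_def)
    then show ?thesis by (metis closure_subset rangeI subsetD)
  qed
  have cluster: "x = 0" if "limitin weak_topology b x H" "H \<le> sequentially" "H \<noteq> bot" for x H
  proof -
    have xW: "x \<in> ?W"
      using weak_limit_in_closed_subspace[OF closure_rat_comb_subspace closed_closure bW that(1,3)] .
    have zero: "blinfun_apply (\<psi> (rat_comb b p)) x = 0" for p
      using that(1) tendsto_mono[OF that(2) null[of p]] tendsto_unique[OF that(3)]
      unfolding limitin_weak_topology_iff by blast
    have "norm x \<le> e" if e: "e > 0" for e :: real
    proof -
      obtain p where p: "dist (rat_comb b p) x < e / 2"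
        using xW e closure_approachable[of x] by (metis half_gt_zero image_iff)
      let ?w = "rat_comb b p"
      have "norm ?w = blinfun_apply (\<psi> ?w) (?w - x)" using \<psi>(1)[of ?w] zero[of p] by (simp add: blinfun.diff_right)
      also have "\<dots> \<le> norm (?w - x)" by (rule \<psi>(2))
      finally show ?thesis using p norm_triangle_ineq2[of x ?w] by (simp add: dist_norm norm_minus_commute)
    qed
    then show ?thesis using field_le_epsilon[of "norm x" 0] by simp
  qed
  have "(\<lambda>n. blinfun_apply f (b n)) \<longlonglongrightarrow> 0" for f :: "'a \<Rightarrow>\<^sub>L real"
  proof (rule ccontr)
    assume "\<not> ?thesis"
    then obtain e where e: "e > 0" "\<not> eventually (\<lambda>n. dist (blinfun_apply f (b n)) 0 < e) sequentially"
      unfolding tendsto_iff by blast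
    \<comment> \<open>Along \<open>G\<close> the functional \<open>f\<close> stays away from 0, which contradicts the existence of a cluster point 0 below \<open>G\<close>.\<close>
    define G where "G = inf sequentially (principal {n. \<not> dist (blinfun_apply f (b n)) 0 < e})"
    have "G \<noteq> bot" using e(2) by (simp add: G_def trivial_limit_def eventually_inf_principal)
    from bounded_weak_cluster_point[where a = b, OF refl M this]
    obtain H x where H: "H \<le> G" "H \<noteq> bot" "limitin weak_topology b x H" by blast
    have "H \<le> sequentially" using H(1) by (simp add: G_def)
    with H cluster have "x = 0" by blast
    then have "((\<lambda>n. blinfun_apply f (b n)) \<longlongrightarrow> 0) H"
      using H(3) unfolding limitin_weak_topology_iff by (metis blinfun.zero_right)
    then have "eventually (\<lambda>n. dist (blinfun_apply f (b n)) 0 < e) H" using e(1) by (rule tendstoD)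
    moreover have "eventually (\<lambda>n. \<not> dist (blinfun_apply f (b n)) 0 < e) G"
      unfolding G_def eventually_inf_principal by simp
    then have "eventually (\<lambda>n. \<not> dist (blinfun_apply f (b n)) 0 < e) H" using H(1) by (simp add: filter_leD)
    ultimately have "eventually (\<lambda>n. False) H" by eventually_elim simp
    then show False using H(2) by (simp add: trivial_limit_def)
  qed
  then have "(\<lambda>n. blinfun_apply f (a n)) \<longlonglongrightarrow> blinfun_apply f u" for f :: "'a \<Rightarrow>\<^sub>L real"
    using tendsto_add[of "\<lambda>n. blinfun_apply f (b n)" 0 sequentially "\<lambda>n. blinfun_apply f u"]
    by (simp add: a_def blinfun.add_right)
  then show ?thesis using aA by (intro exI[of _ a]) (auto simp: limitin_weak_topology_iff)
qed

text \<open>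
  Reflexivity and separability of the dual serve the same purpose: either way, sequences detect the
  weak closure of a bounded set.
\<close>
lemma seq_weakly_closed_imp_closedin_weak:
  fixes A :: "'a::real_normed_vector set"
  assumes V: "reflexive_space TYPE('a) \<or> separable_dual TYPE('a)" and A: "bounded A"
    and seq: "\<And>a u. range a \<subseteq> A \<Longrightarrow> limitin weak_topology a u sequentially \<Longrightarrow> u \<in> A"
  shows "closedin weak_topology A"
proof -
  have "u \<in> A" if u: "u \<in> weak_topology closure_of A" for u
  proof -
    have "\<exists>a. range a \<subseteq> A \<and> limitin weak_topology a u sequentially"
      using V
    proof
      assume "reflexive_space TYPE('a)"
      then show ?thesis using A u by (rule bounded_weak_closure_sequence_reflexive)
    next
      assume "separable_dual TYPE('a)"
      then show ?thesis using A u by (rule bounded_weak_closure_sequence_separable_dual)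
    qed
    then show ?thesis using seq by blast
  qed
  then show ?thesis
    using closure_of_subset_eq[of A weak_topology] by auto
qed

section \<open>Gamma-limits and comparison of topologies\<close>

lemma openin_weak_imp_open:
  fixes U :: "'a::real_normed_vector set"
  assumes "openin weak_topology U"
  shows "open U"
proof -
  have "generate_topology_on {blinfun_apply f -` S |(f :: 'a \<Rightarrow>\<^sub>L real) S. open S} U"
    using assms by (simp add: weak_topology_def openin_topology_generated_by_iff)
  then show ?thesis
    by induction (auto intro!: open_vimage blinfun.continuous_on continuous_on_id)
qed

lemma Gamma_limsup_mono_topology:
  assumes "\<And>U. openin S U \<Longrightarrow> openin T U"
  shows "Gamma_limsup S G u \<le> Gamma_limsup T G u"
  unfolding Gamma_limsup_def using assms by (intro SUP_subset_mono) auto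

lemma Gamma_liminf_mono_topology:
  assumes "\<And>U. openin S U \<Longrightarrow> openin T U"
  shows "Gamma_liminf S G u \<le> Gamma_liminf T G u"
  unfolding Gamma_liminf_def using assms by (intro SUP_subset_mono) auto

lemma Gamma_liminf_le_limsup: "Gamma_liminf T G u \<le> Gamma_limsup T G u"
  unfolding Gamma_liminf_def Gamma_limsup_def by (intro SUP_subset_mono order_refl Liminf_le_Limsup) simp

section \<open>Bounds for quasi-monotone perturbations\<close>

lemma coercive_bounded_sublevel:
  assumes "coercive F"
  shows "bounded {w. F w \<le> t}"
proof -
  have "\<forall>\<^sub>F w in at_infinity. t < F w"
    using assms unfolding coercive_def filterlim_at_top_dense by blast
  then obtain B where "\<And>w. B \<le> norm w \<Longrightarrow> t < F w" unfolding eventually_at_infinity by blast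
  then show ?thesis unfolding bounded_iff by (metis linorder_not_le mem_Collect_eq nle_le)
qed

text \<open>
  Coercivity of \<open>F\<close> and \<open>0 \<le> \<rho>\<close> make the sublevel sets of \<open>F + \<rho>\<close> bounded, so they are weakly
  closed as soon as they are weakly sequentially closed. This turns sequential into topological
  weak lower semicontinuity.
\<close>
lemma openin_weak_superlevel:
  fixes F :: "'a::real_normed_vector \<Rightarrow> real" and \<rho> :: "'a \<Rightarrow> ereal"
  assumes V: "reflexive_space TYPE('a) \<or> separable_dual TYPE('a)"
    and F: "coercive F" "seq_weakly_lsc (\<lambda>u. ereal (F u))"
    and \<rho>: "seq_weakly_lsc \<rho>" "\<And>u. 0 \<le> \<rho> u"
  shows "openin weak_topology {w. ereal t < ereal (F w) + \<rho> w}"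
proof -
  let ?A = "{w. ereal (F w) + \<rho> w \<le> ereal t}"
  have "?A \<subseteq> {w. F w \<le> t}"
  proof safe
    fix w assume "ereal (F w) + \<rho> w \<le> ereal t"
    moreover have "ereal (F w) \<le> ereal (F w) + \<rho> w"
      using add_left_mono[OF \<rho>(2), of "ereal (F w)" w] by simp
    ultimately have "ereal (F w) \<le> ereal t" by (metis order_trans)
    then show "F w \<le> t" by simp
  qed
  then have "bounded ?A" using coercive_bounded_sublevel[OF F(1)] bounded_subset by blast
  then have "closedin weak_topology ?A"
  proof (rule seq_weakly_closed_imp_closedin_weak[OF V])
    fix a u assume a: "range a \<subseteq> ?A" and lim: "limitin weak_topology a u sequentially"
    have 1: "ereal (F u) \<le> liminf (\<lambda>k. ereal (F (a k)))" and 2: "\<rho> u \<le> liminf (\<lambda>k. \<rho> (a k))"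
      using F(2) \<rho>(1) lim unfolding seq_weakly_lsc_def by blast+
    have "ereal (F u) + \<rho> u \<le> liminf (\<lambda>k. ereal (F (a k))) + liminf (\<lambda>k. \<rho> (a k))"
      using 1 2 by (rule add_mono)
    also have "\<dots> \<le> liminf (\<lambda>k. ereal (F (a k)) + \<rho> (a k))"
      using 1 2 \<rho>(2)[of u] by (intro ereal_liminf_add_mono) auto
    also have "\<dots> \<le> liminf (\<lambda>k. ereal t)" using a by (intro Liminf_mono always_eventually) auto
    also have "\<dots> = ereal t" by (simp add: Liminf_const)
    finally show "u \<in> ?A" by simp
  qed
  then have "openin weak_topology (UNIV - ?A)" by (simp add: closedin_def)
  moreover have "UNIV - ?A = {w. ereal t < ereal (F w) + \<rho> w}" by auto
  ultimately show ?thesis by simp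
qed

text \<open>
  If \<open>t\<close> lies below the limit value at \<open>u\<close>, then \<open>t < F u + \<rho> n u\<close> for some \<open>n\<close>, and
  the superlevel set of \<open>F + \<rho> n\<close> is a weak neighbourhood of \<open>u\<close> on which, by
  monotonicity, all later \<open>F + R m\<close> stay above \<open>t\<close>.
\<close>
lemma weak_Gamma_liminf_lower_bound:
  fixes F :: "'a::real_normed_vector \<Rightarrow> real" and \<rho> R :: "nat \<Rightarrow> 'a \<Rightarrow> ereal"
  assumes V: "reflexive_space TYPE('a) \<or> separable_dual TYPE('a)"
    and F: "coercive F" "seq_weakly_lsc (\<lambda>u. ereal (F u))"
    and \<rho>: "\<And>n. seq_weakly_lsc (\<rho> n)" "\<And>n u. 0 \<le> \<rho> n u" "\<And>n u. \<rho> n u \<le> \<rho> (Suc n) u"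
    and R: "\<And>n u. \<rho> n u \<le> R n u" and lim: "(\<lambda>n. \<rho> n u) \<longlonglongrightarrow> l"
  shows "ereal (F u) + l \<le> Gamma_liminf weak_topology (\<lambda>n w. ereal (F w) + R n w) u"
proof (rule dense_le)
  fix t assume t: "t < ereal (F u) + l"
  show "t \<le> Gamma_liminf weak_topology (\<lambda>n w. ereal (F w) + R n w) u"
  proof (cases t)
    case (real r)
    have "l \<noteq> -\<infinity>" using LIMSEQ_le_const[OF lim, of 0] \<rho>(2) by auto
    then have "(\<lambda>n. ereal (F u) + \<rho> n u) \<longlonglongrightarrow> ereal (F u) + l"
      by (intro tendsto_add_ereal_general lim tendsto_const) auto
    from order_tendstoD(1)[OF this t] obtain n where n: "t < ereal (F u) + \<rho> n u"
      by (auto simp: eventually_sequentially)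
    define U where "U = {w. ereal r < ereal (F w) + \<rho> n w}"
    have U: "openin weak_topology U" "u \<in> U"
      using openin_weak_superlevel[OF V F \<rho>(1,2)] n real by (auto simp: U_def)
    have "t \<le> (INF w \<in> U. ereal (F w) + R m w)" if "m \<ge> n" for m
    proof (rule INF_greatest)
      fix w assume "w \<in> U"
      then have "t \<le> ereal (F w) + \<rho> n w" by (simp add: U_def real)
      also have "\<rho> n w \<le> R m w"
        using lift_Suc_mono_le[of "\<lambda>n. \<rho> n w", OF \<rho>(3) that] R order_trans by blast
      finally show "t \<le> ereal (F w) + R m w" by (simp add: add_left_mono)
    qed
    then have "t \<le> liminf (\<lambda>m. INF w \<in> U. ereal (F w) + R m w)"
      by (intro Liminf_bounded) (auto simp: eventually_sequentially)
    also have "\<dots> \<le> Gamma_liminf weak_topology (\<lambda>n w. ereal (F w) + R n w) u"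
      unfolding Gamma_liminf_def by (rule SUP_upper) (use U in auto)
    finally show ?thesis .
  qed (use t in auto)
qed

text \<open>
  A constant recovery sequence suffices: near \<open>u\<close> there is a point \<open>w\<close> of \<open>D\<close> with \<open>F w\<close> close to
  \<open>F u\<close>, and the perturbation at \<open>w\<close> vanishes in the limit.
\<close>
lemma strong_Gamma_limsup_upper_bound:
  fixes F :: "'a::topological_space \<Rightarrow> real" and \<rho> R :: "nat \<Rightarrow> 'a \<Rightarrow> ereal"
  assumes F: "continuous_on UNIV F"
    and R: "\<And>n u. R n u \<le> \<rho> n u" and lim: "\<And>w. w \<in> D \<Longrightarrow> (\<lambda>n. \<rho> n w) \<longlonglongrightarrow> 0"
    and u: "u \<in> closure D"
  shows "Gamma_limsup euclidean (\<lambda>n w. ereal (F w) + R n w) u \<le> ereal (F u)"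
  unfolding Gamma_limsup_def
proof (rule SUP_least)
  fix U assume "U \<in> {U. openin euclidean U \<and> u \<in> U}"
  then have U: "open U" "u \<in> U" by auto
  show "limsup (\<lambda>n. INF w \<in> U. ereal (F w) + R n w) \<le> ereal (F u)"
  proof (rule ereal_le_epsilon2)
    fix e :: real assume e: "e > 0"
    have "open (F -` {..<F u + e})" using F by (intro open_vimage) auto
    then obtain w where w: "w \<in> D" "w \<in> U" "F w < F u + e"
      using open_Int_closure_eq_empty[OF open_Int[OF U(1)], of "F -` {..<F u + e}" D] U(2) u e by fastforce
    have "limsup (\<lambda>n. INF w \<in> U. ereal (F w) + R n w) \<le> limsup (\<lambda>n. ereal (F w) + \<rho> n w)"
      by (intro Limsup_mono always_eventually allI INF_lower2[OF w(2)] add_left_mono R)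
    also have "(\<lambda>n. ereal (F w) + \<rho> n w) \<longlonglongrightarrow> ereal (F w) + 0"
      by (intro tendsto_add_ereal_general lim w tendsto_const) auto
    then have "limsup (\<lambda>n. ereal (F w) + \<rho> n w) = ereal (F w)"
      by (simp add: lim_imp_Limsup)
    also have "\<dots> \<le> ereal (F u) + ereal e" using w(3) by simp
    finally show "limsup (\<lambda>n. INF w \<in> U. ereal (F w) + R n w) \<le> ereal (F u) + ereal e" .
  qed
qed

section \<open>Gamma-convergence to the constrained functional\<close>

text \<open>
  Passing to a coarser topology decreases both Gamma-limits. The upper bound for the
  strong Gamma-limsup and the lower bound for the weak Gamma-liminf therefore enclose all four.
\<close>
theorem theorem4p2:
  fixes F :: "'a::banach \<Rightarrow> real"
    and K Y :: "'a set"
    and R :: "nat \<Rightarrow> 'a \<Rightarrow> ereal"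
  assumes "reflexive_space TYPE('a) \<or> separable_dual TYPE('a)"
    and "continuous_on UNIV F"
    and "coercive F"
    and "seq_weakly_lsc (\<lambda>u. ereal (F u))"
    and "K \<noteq> {}" and "closed K" and "convex K"
    and "subspace Y" and "closure Y = UNIV"
    and "quasi_monotone_perturbations K Y R"
    and "closure (K \<inter> Y) = K"
  shows "\<forall>u. has_Gamma_limit_at euclidean (\<lambda>n w. ereal (F w) + R n w) u
               (ereal (F u) + ext_indicator K u) \<and>
             has_Gamma_limit_at weak_topology (\<lambda>n w. ereal (F w) + R n w) u
               (ereal (F u) + ext_indicator K u)"
proof
  fix u
  obtain Rl Ru :: "nat \<Rightarrow> 'a \<Rightarrow> ereal" where
      Rl0: "\<And>n u. 0 \<le> Rl n u" and lower: "\<And>n u. Rl n u \<le> R n u" and upper: "\<And>n u. R n u \<le> Ru n u"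
      and mono: "\<And>n u. Rl n u \<le> Rl (Suc n) u" and limRl: "\<And>u. (\<lambda>n. Rl n u) \<longlonglongrightarrow> ext_indicator K u"
      and lsc: "\<And>n. seq_weakly_lsc (Rl n)"
      and limRu: "\<And>u. (\<lambda>n. Ru n u) \<longlonglongrightarrow> ext_indicator (K \<inter> Y) u"
    using assms(10) unfolding quasi_monotone_perturbations_def by blast
  let ?G = "\<lambda>n w. ereal (F w) + R n w" and ?l = "ereal (F u) + ext_indicator K u"
  have low: "?l \<le> Gamma_liminf weak_topology ?G u"
    by (rule weak_Gamma_liminf_lower_bound[OF assms(1,3,4) lsc Rl0 mono lower limRl])
  have high: "Gamma_limsup euclidean ?G u \<le> ?l"
  proof (cases "u \<in> K")
    case True
    have "Gamma_limsup euclidean ?G u \<le> ereal (F u)"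
    proof (rule strong_Gamma_limsup_upper_bound[OF assms(2) upper])
      show "(\<lambda>n. Ru n w) \<longlonglongrightarrow> 0" if "w \<in> K \<inter> Y" for w
        using limRu[of w] that by (simp add: ext_indicator_def)
      show "u \<in> closure (K \<inter> Y)" using assms(11) True by simp
    qed
    then show ?thesis using True by (simp add: ext_indicator_def)
  qed (simp add: ext_indicator_def)
  have coarser: "openin euclidean U" if "openin weak_topology U" for U :: "'a set"
    using openin_weak_imp_open[OF that] by simp
  have "Gamma_liminf weak_topology ?G u \<le> Gamma_liminf euclidean ?G u"
    and "Gamma_limsup weak_topology ?G u \<le> Gamma_limsup euclidean ?G u"
    by (intro Gamma_liminf_mono_topology Gamma_limsup_mono_topology coarser; assumption)+
  then show "has_Gamma_limit_at euclidean ?G u ?l \<and> has_Gamma_limit_at weak_topology ?G u ?l"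
    using low high Gamma_liminf_le_limsup[of euclidean ?G u] Gamma_liminf_le_limsup[of weak_topology ?G u]
    unfolding has_Gamma_limit_at_def by (meson order.antisym order_trans)
qed

end
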